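(* Let $M \ge 2$ be an integer, let $\sigma > 0$, let $z \in \mathbb{C}$ be arbitrary, and let $\eta$ be a circular complex Gaussian random variable with mean zero and variance $\sigma^2$. Put $$\alpha = \Re\{z\} - |\Im\{z\}| \cot\left(\frac{\pi}{M}\right), \qquad \Delta z = -|\Im\{z\}|\cot\left(\frac{\pi}{M}\right) - j\,\Im\{z\},$$ $$w = z + \eta, \qquad \hat{z} = z + \Delta z \;(=\alpha), \qquad \hat{w} = \hat{z} + \eta .$$ Then $$\Pr(\mathrm{dec}(w) \neq 1) \le \Pr(\mathrm{dec}(\hat{w}) \neq 1),$$ and $$\Pr(\mathrm{dec}(\hat{w}) \neq 1) \le 2 Q\left( \frac{\alpha}{\sigma/\sqrt{2}} \sin\frac{\pi}{M} \right).$$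
   Context: Here $j$ is the imaginary unit and $\Re\{\cdot\},\Im\{\cdot\}$ denote real and imaginary parts. A circular complex Gaussian random variable with mean zero and variance $\sigma^2$ has independent real and imaginary parts, each distributed as $N(0,\sigma^2/2)$. The $M$-ary PSK constellation is $\mathcal{S} = \{ e^{j n \frac{2\pi}{M}} : n = 0,\ldots,M-1 \}$. The decision function $\mathrm{dec}: \mathbb{C} \to \mathcal{S}$ is $\mathrm{dec}(y) = e^{j\hat{n}\frac{2\pi}{M}}$, where $\hat{n} \in \{0,\ldots,M-1\}$ is such that the phase angle of $y$ (modulo $2\pi$) lies in $\left[\frac{2\pi\hat{n}}{M} - \frac{\pi}{M}, \frac{2\pi\hat{n}}{M} + \frac{\pi}{M}\right]$; ties on the boundaries of these sectors (including $y=0$), a Lebesgue-null set, may be resolved by any fixed measurable rule. The function $Q$ is $Q(x) = \int_x^\infty \frac{1}{\sqrt{2\pi}} e^{-u^2/2}\, du$ for $x \in \mathbb{R}$. *)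

theory Defs
  imports "HOL-Probability.Probability"
begin

definition circular_complex_gaussian :: "'a measure \<Rightarrow> ('a \<Rightarrow> complex) \<Rightarrow> real \<Rightarrow> bool" where
  "circular_complex_gaussian \<Omega> X v \<longleftrightarrow>
     prob_space.indep_var \<Omega> borel (\<lambda>\<omega>. Re (X \<omega>)) borel (\<lambda>\<omega>. Im (X \<omega>)) \<and>
     distributed \<Omega> lborel (\<lambda>\<omega>. Re (X \<omega>)) (\<lambda>x. ennreal (normal_density 0 (sqrt (v / 2)) x)) \<and>
     distributed \<Omega> lborel (\<lambda>\<omega>. Im (X \<omega>)) (\<lambda>x. ennreal (normal_density 0 (sqrt (v / 2)) x))"

definition psk_constellation :: "nat \<Rightarrow> complex set" where
  "psk_constellation M = {cis (real n * (2 * pi / real M)) | n. n < M}"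

text \<open>A phase angle of \<open>y\<close> is any real \<open>\<theta>\<close> with \<open>y = rcis (norm y) \<theta>\<close>, so the modulus
  \<open>2\<pi>\<close> is built in and every real is a phase angle of \<open>0\<close>. The closed sectors overlap on their
  boundary rays; the predicate holds for every Borel measurable way of resolving these ties.\<close>

definition psk_decision :: "nat \<Rightarrow> (complex \<Rightarrow> complex) \<Rightarrow> bool" where
  "psk_decision M dec \<longleftrightarrow>
     dec \<in> borel_measurable borel \<and> range dec \<subseteq> psk_constellation M \<and>
     (\<forall>y. \<exists>n<M. dec y = cis (real n * (2 * pi / real M)) \<and>
        (\<exists>\<theta>. y = rcis (norm y) \<theta> \<and>
             \<theta> \<in> {2 * pi * real n / real M - pi / real M .. 2 * pi * real n / real M + pi / real M}))"

definition Q :: "real \<Rightarrow> real" where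
  "Q x = (LBINT u:{x..}. 1 / sqrt (2 * pi) * exp (- u\<^sup>2 / 2))"

end

theory Submission
  imports Defs
begin

text \<open>The closed sector of the symbol \<open>1\<close> is a convex cone, the intersection of the half-planes
  \<open>sin (\<pi>/M) Re y \<plusminus> cos (\<pi>/M) Im y \<ge> 0\<close>, and \<open>-\<Delta>z\<close> lies in it. Hence \<open>w = what - \<Delta>z\<close> lies in the
  sector whenever \<open>what\<close> does, and ties do not matter because each of the two linear forms in the
  noise is again Gaussian with variance \<open>\<sigma>\<^sup>2/2\<close>. The second bound is the union bound over
  the two complementary half-planes.\<close>

text \<open>Independent centred normals add their variances, and
  \<open>a\<^sup>2 + b\<^sup>2 = 1\<close> keeps the total at \<open>s\<^sup>2\<close>. It will be
  applied with \<open>a = - sin (pi / M)\<close> and \<open>b\<close> equal to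
  \<open>cos (pi / M)\<close> up to sign.\<close>

lemma rotated_normal:
  assumes "prob_space \<Omega>"
    and "prob_space.indep_var \<Omega> borel X borel Y"
    and X: "distributed \<Omega> lborel X (\<lambda>x. ennreal (normal_density 0 s x))"
    and Y: "distributed \<Omega> lborel Y (\<lambda>x. ennreal (normal_density 0 s x))"
    and "s > 0" and ab: "a\<^sup>2 + b\<^sup>2 = 1"
  shows "distributed \<Omega> lborel (\<lambda>\<omega>. a * X \<omega> + b * Y \<omega>) (\<lambda>x. ennreal (normal_density 0 s x))"
proof -
  interpret prob_space \<Omega> by fact
  have scaled: "distributed \<Omega> lborel (\<lambda>\<omega>. c * Z \<omega>) (\<lambda>x. ennreal (normal_density 0 (\<bar>c\<bar> * s) x))"
    if "distributed \<Omega> lborel Z (\<lambda>x. ennreal (normal_density 0 s x))" "c \<noteq> 0" for c Z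
    using normal_density_affine[OF that(1) \<open>s > 0\<close> that(2), of 0] by simp
  have unit: "\<bar>c\<bar> = 1" if "c\<^sup>2 = 1" for c :: real
    using that by (auto simp: power2_eq_1_iff)
  \<comment> \<open>A zero coefficient gives a constant summand without a density, so the sum rule
    covers only the third case. The case \<open>b = 0\<close> does arise:
    \<open>cos (pi / M) = 0\<close> for \<open>M = 2\<close>.\<close>
  consider "a = 0" | "b = 0" | "a \<noteq> 0" "b \<noteq> 0" by blast
  then show ?thesis
  proof cases
    case 1
    with ab unit[of b] scaled[OF Y, of b] show ?thesis by auto
  next
    case 2
    with ab unit[of a] scaled[OF X, of a] show ?thesis by auto
  next
    case 3
    have "indep_var borel ((*) a \<circ> X) borel ((*) b \<circ> Y)"
      by (rule indep_var_compose) (use assms in auto)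
    then have "distributed \<Omega> lborel (\<lambda>\<omega>. a * X \<omega> + b * Y \<omega>)
        (\<lambda>x. ennreal (normal_density (0 + 0) (sqrt ((\<bar>a\<bar> * s)\<^sup>2 + (\<bar>b\<bar> * s)\<^sup>2)) x))"
      using 3 \<open>s > 0\<close> by (intro add_indep_normal scaled X Y) (auto simp: comp_def)
    moreover have "(\<bar>a\<bar> * s)\<^sup>2 + (\<bar>b\<bar> * s)\<^sup>2 = s\<^sup>2"
      using ab by (simp add: power_mult_distrib flip: distrib_right)
    ultimately show ?thesis using \<open>s > 0\<close> by simp
  qed
qed

lemma normal_tail_eq_Q:
  assumes "prob_space \<Omega>"
    and X: "distributed \<Omega> lborel X (\<lambda>x. ennreal (normal_density 0 s x))" and "s > 0"
  shows "\<P>(\<omega> in \<Omega>. X \<omega> \<ge> t) = Q (t / s)"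
proof -
  interpret prob_space \<Omega> by fact
  have D: "distributed \<Omega> lborel (\<lambda>\<omega>. X \<omega> / s) (\<lambda>x. ennreal (std_normal_density x))"
    using X normal_standard_normal_convert[OF \<open>s > 0\<close>, of X 0] by simp
  note [measurable] = distributed_measurable[OF D]
  have "Q (t / s) = (\<integral>x. std_normal_density x * indicator {t / s..} x \<partial>lborel)"
    unfolding Q_def set_lebesgue_integral_def std_normal_density_def
    by (simp add: mult.commute)
  also have "\<dots> = (\<integral>\<omega>. indicator {t / s..} (X \<omega> / s) \<partial>\<Omega>)"
    by (rule distributed_integral[OF D]) auto
  also have "\<dots> = (\<integral>\<omega>. indicator {\<omega> \<in> space \<Omega>. X \<omega> \<ge> t} \<omega> \<partial>\<Omega>)"
    using \<open>s > 0\<close> by (intro Bochner_Integration.integral_cong) (auto simp: indicator_def field_simps)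
  also have "\<dots> = \<P>(\<omega> in \<Omega>. X \<omega> \<ge> t)"
    by (auto intro!: arg_cong[where f = prob])
  finally show ?thesis by simp
qed

text \<open>A law with a Lebesgue density has no atoms. This makes the noise values that put
  \<open>what\<close> on a boundary line of the sector negligible.\<close>

lemma distributed_lborel_AE_neq:
  fixes X :: "'a \<Rightarrow> real"
  assumes "distributed \<Omega> lborel X f"
  shows "AE \<omega> in \<Omega>. X \<omega> \<noteq> c"
proof -
  have "AE x in density lborel f. x \<noteq> c"
    using AE_lborel_singleton[of c] distributed_borel_measurable[OF assms]
    by (subst AE_density) auto
  then show ?thesis
    using AE_distrD[OF distributed_measurable[OF assms], of "\<lambda>x. x \<noteq> c"]
    unfolding distributed_distr_eq_density[OF assms] by blast
qed

lemma psk_decision_polar: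
  assumes "psk_decision M dec"
  obtains n \<theta> where "n < M" "dec y = cis (real n * (2 * pi / M))"
    "Re y = norm y * cos \<theta>" "Im y = norm y * sin \<theta>"
    "2 * (pi / M) * n - pi / M \<le> \<theta>" "\<theta> \<le> 2 * (pi / M) * n + pi / M"
proof -
  obtain n \<theta> where n: "n < M" "dec y = cis (real n * (2 * pi / M))" and y: "y = rcis (norm y) \<theta>"
    and \<theta>: "\<theta> \<in> {2 * pi * real n / M - pi / M .. 2 * pi * real n / M + pi / M}"
    using assms unfolding psk_decision_def by blast
  have "Re y = norm y * cos \<theta>" "Im y = norm y * sin \<theta>"
    using arg_cong[OF y, of Re] arg_cong[OF y, of Im] by simp_all
  with n \<theta> show thesis by (intro that[of n \<theta>]) (simp_all add: mult_ac)
qed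

text \<open>Deciding 1 forces \<open>n = 0\<close>, so with \<open>t = pi / M\<close> the phase lies
  in \<open>[-t, t]\<close>. The form is \<open>norm y * sin (t + b * \<theta>)\<close>, whose angle
  lies in \<open>[0, 2 * t]\<close>, a subset of \<open>[0, pi]\<close> because
  \<open>M \<ge> 2\<close>.\<close>

lemma psk_decision_eq_1_imp:
  assumes dec: "psk_decision M dec" and "M \<ge> 2" and "dec y = 1" and b: "b = 1 \<or> b = -1"
  shows "sin (pi / M) * Re y + b * cos (pi / M) * Im y \<ge> 0"
proof -
  define t where "t = pi / M"
  have t: "0 < t" "t \<le> pi / 2" using \<open>M \<ge> 2\<close> by (auto simp: t_def field_simps)
  obtain n \<theta> where n: "n < M" "cis (real n * (2 * pi / M)) = 1"
    and y: "Re y = norm y * cos \<theta>" "Im y = norm y * sin \<theta>"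
    and \<theta>: "2 * t * n - t \<le> \<theta>" "\<theta> \<le> 2 * t * n + t"
    using psk_decision_polar[OF dec, of y] \<open>dec y = 1\<close> unfolding t_def by metis
  \<comment> \<open>The constellation points are distinct: the value 1 makes \<open>M\<close> divide
    \<open>n\<close>, while \<open>n < M\<close>.\<close>
  have "n = 0"
  proof (rule ccontr)
    assume "n \<noteq> 0"
    from n(2) have "cos (real n * (2 * pi / M)) = 1" by (simp add: complex_eq_iff)
    then obtain k :: int where "real n * (2 * pi / M) = of_int k * 2 * pi"
      by (auto simp: cos_one_2pi_int)
    then have "real_of_int (int n) = real_of_int (k * int M)"
      using \<open>M \<ge> 2\<close> by (simp add: field_simps)
    then have "int n = k * int M" by linarith
    then have "int M dvd int n" by simp
    then show False using n(1) \<open>n \<noteq> 0\<close> by (simp add: nat_dvd_not_less)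
  qed
  have "sin t * Re y + b * cos t * Im y = norm y * sin (t + b * \<theta>)"
    using b by (auto simp: y sin_add sin_diff algebra_simps)
  moreover have "sin (t + b * \<theta>) \<ge> 0"
    using b \<theta> t \<open>n = 0\<close> by (intro sin_ge_zero) auto
  ultimately show ?thesis by (simp add: t_def)
qed

text \<open>A symbol index from 1 to \<open>M - 1\<close> confines the phase to
  \<open>[t, 2 * pi - t]\<close> with \<open>t = pi / M\<close>. The inequality is weak since a tie
  on the boundary of the sector of 1 may be resolved to a neighbouring symbol.\<close>

lemma psk_decision_neq_1_imp:
  assumes dec: "psk_decision M dec" and "M \<ge> 2" and "dec y \<noteq> 1"
  shows "\<exists>b\<in>{1, -1}. sin (pi / M) * Re y + b * cos (pi / M) * Im y \<le> 0"
proof -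
  define t where "t = pi / M"
  have t: "0 < t" "t * M = pi" using \<open>M \<ge> 2\<close> by (auto simp: t_def)
  obtain n \<theta> where n: "n < M" "dec y = cis (real n * (2 * pi / M))"
    and y: "Re y = norm y * cos \<theta>" "Im y = norm y * sin \<theta>"
    and \<theta>: "2 * t * n - t \<le> \<theta>" "\<theta> \<le> 2 * t * n + t"
    using psk_decision_polar[OF dec, of y] unfolding t_def by metis
  have "n \<noteq> 0" using n(2) \<open>dec y \<noteq> 1\<close> by (cases n) auto
  then have "t * 1 \<le> t * real n" "t * (real n + 1) \<le> t * real M"
    using t(1) n(1) by (intro mult_left_mono; simp)+
  then have \<theta>': "t \<le> \<theta>" "\<theta> \<le> 2 * pi - t"
    using \<theta> t(2) by (auto simp: algebra_simps)
  have eq: "sin t * Re y + b * cos t * Im y = norm y * sin (t + b * \<theta>)" if "b = 1 \<or> b = -1" for b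
    using that by (auto simp: y sin_add sin_diff algebra_simps)
  show ?thesis
  \<comment> \<open>In the upper half-plane \<open>\<theta> - t\<close> lies in
    \<open>[0, pi]\<close>, so \<open>b = -1\<close> violates positivity; in the lower one
    \<open>\<theta> + t\<close> lies in \<open>[pi, 2 * pi]\<close>, so \<open>b = 1\<close>
    does.\<close>
  proof (cases "\<theta> \<le> pi")
    case True
    then have "sin (\<theta> - t) \<ge> 0" using \<theta>' t by (intro sin_ge_zero) auto
    moreover have "sin (t + (-1) * \<theta>) = - sin (\<theta> - t)" by (simp flip: sin_minus)
    ultimately have "sin t * Re y + (-1) * cos t * Im y \<le> 0"
      by (subst eq) (auto intro: mult_nonneg_nonpos)
    then show ?thesis unfolding t_def by blast
  next
    case False
    then have "sin (\<theta> + t - pi) \<ge> 0" using \<theta>' t by (intro sin_ge_zero) auto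
    then have "sin (t + 1 * \<theta>) \<le> 0" by (simp add: sin_diff add.commute)
    then have "sin t * Re y + 1 * cos t * Im y \<le> 0"
      by (subst eq) (auto intro: mult_nonneg_nonpos)
    then show ?thesis unfolding t_def by blast
  qed
qed

theorem proposition1:
  fixes M :: nat and \<sigma> \<alpha> :: real and z \<Delta>z zhat :: complex
    and \<Omega> :: "'a measure" and \<eta> w what :: "'a \<Rightarrow> complex"
    and dec :: "complex \<Rightarrow> complex"
  assumes "M \<ge> 2" and "\<sigma> > 0"
    and "prob_space \<Omega>"
    and "circular_complex_gaussian \<Omega> \<eta> (\<sigma>\<^sup>2)"
    and "psk_decision M dec"
    and "\<alpha> = Re z - \<bar>Im z\<bar> * cot (pi / real M)"
    and "\<Delta>z = - complex_of_real (\<bar>Im z\<bar> * cot (pi / real M)) - \<i> * complex_of_real (Im z)"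
    and "w = (\<lambda>\<omega>. z + \<eta> \<omega>)"
    and "zhat = z + \<Delta>z"
    and "what = (\<lambda>\<omega>. zhat + \<eta> \<omega>)"
  shows "zhat = complex_of_real \<alpha> \<and>
    \<P>(\<omega> in \<Omega>. dec (w \<omega>) \<noteq> 1) \<le> \<P>(\<omega> in \<Omega>. dec (what \<omega>) \<noteq> 1) \<and>
    \<P>(\<omega> in \<Omega>. dec (what \<omega>) \<noteq> 1) \<le> 2 * Q (\<alpha> / (\<sigma> / sqrt 2) * sin (pi / real M))"
proof -
  interpret prob_space \<Omega> by fact
  define t where "t = pi / real M"
  define s where "s = \<sigma> / sqrt 2"
  have "s > 0" using \<open>\<sigma> > 0\<close> by (simp add: s_def)
  have s: "sqrt (\<sigma>\<^sup>2 / 2) = s" using \<open>\<sigma> > 0\<close> by (simp add: s_def real_sqrt_divide)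
  have t: "0 < t" "t \<le> pi / 2" using \<open>M \<ge> 2\<close> by (auto simp: t_def field_simps)
  have "sin t > 0" using t by (intro sin_gt_zero) auto
  have "cos t \<ge> 0" using t by (intro cos_ge_zero) auto
  have zhat: "zhat = complex_of_real \<alpha>"
    using assms by (simp add: complex_eq_iff)
  \<comment> \<open>Multiplying by \<open>sin t\<close> clears the cotangent. The result is the
    smaller of the two values \<open>sin t * Re z \<plusminus> cos t * Im z\<close>, and both forms
    take it at \<open>zhat\<close>.\<close>
  have \<alpha>_sin: "\<alpha> * sin t = sin t * Re z - cos t * \<bar>Im z\<bar>"
    using assms \<open>sin t > 0\<close> by (simp add: cot_def t_def field_simps)

  define L where "L b y = sin t * Re y + b * cos t * Im y" for b and y :: complex
  \<comment> \<open>The sign is reversed so that \<open>L b (what \<omega>) \<le> 0\<close> becomes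
    the upper tail event \<open>N b \<omega> \<ge> \<alpha> * sin t\<close>, the shape of
    \<open>Q\<close>.\<close>
  define N where "N b \<omega> = - sin t * Re (\<eta> \<omega>) + - (b * cos t) * Im (\<eta> \<omega>)" for b \<omega>
  have N: "distributed \<Omega> lborel (N b) (\<lambda>x. ennreal (normal_density 0 s x))" if "b \<in> {1, -1}" for b
    unfolding N_def
    by (rule rotated_normal)
       (use assms that \<open>s > 0\<close> in \<open>auto simp: circular_complex_gaussian_def s\<close>)
  have Lhat: "L b (what \<omega>) = \<alpha> * sin t - N b \<omega>" for b \<omega>
    unfolding assms(10) zhat by (simp add: L_def N_def algebra_simps)
  \<comment> \<open>The difference of the two sides is \<open>L b (- \<Delta>z) = cos t * \<bar>Im
    z\<bar> + b * cos t * Im z\<close>, nonnegative for either sign \<open>b\<close>.\<close>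
  have Lw: "L b (what \<omega>) \<le> L b (w \<omega>)" if "b \<in> {1, -1}" for b \<omega>
  proof -
    have "\<bar>cos t * Im z\<bar> = cos t * \<bar>Im z\<bar>" using \<open>cos t \<ge> 0\<close> by (simp add: abs_mult)
    then have "cos t * \<bar>Im z\<bar> + b * cos t * Im z \<ge> 0"
      using that abs_ge_self[of "cos t * Im z"] abs_ge_minus_self[of "cos t * Im z"] by auto
    moreover have "L b (w \<omega>) = L b (what \<omega>) + (cos t * \<bar>Im z\<bar> + b * cos t * Im z)"
      unfolding Lhat \<alpha>_sin using assms(8) by (simp add: L_def N_def algebra_simps)
    ultimately show ?thesis by simp
  qed

  have [measurable]: "\<eta> \<in> borel_measurable \<Omega>"
    using assms(4) unfolding circular_complex_gaussian_def borel_measurable_complex_iff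
    by (auto dest!: distributed_measurable)
  have [measurable]: "dec \<in> borel_measurable borel"
    using assms(5) by (simp add: psk_decision_def)
  have [measurable]: "N b \<in> borel_measurable \<Omega>" for b
    unfolding N_def by measurable
  have [measurable]: "w \<in> borel_measurable \<Omega>" "what \<in> borel_measurable \<Omega>"
    using assms by auto

  \<comment> \<open>The implication can fail on ties, hence the AE. A failure gives
    \<open>0 \<le> L b (what \<omega>) \<le> L b (w \<omega>) \<le> 0\<close> for some
    \<open>b\<close>, so \<open>N b \<omega> = \<alpha> * sin t\<close>, a null event.\<close>
  have dec_w: "AE \<omega> in \<Omega>. dec (w \<omega>) \<noteq> 1 \<longrightarrow> dec (what \<omega>) \<noteq> 1"
  proof -
    have "AE \<omega> in \<Omega>. N 1 \<omega> \<noteq> \<alpha> * sin t" "AE \<omega> in \<Omega>. N (-1) \<omega> \<noteq> \<alpha> * sin t"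
      using N by (auto intro!: distributed_lborel_AE_neq)
    then show ?thesis
    proof eventually_elim
      case (elim \<omega>)
      show ?case
      proof (intro impI notI)
        assume "dec (w \<omega>) \<noteq> 1" and hat: "dec (what \<omega>) = 1"
        then obtain b where b: "b \<in> {1, -1}" "L b (w \<omega>) \<le> 0"
          using psk_decision_neq_1_imp[OF assms(5,1), of "w \<omega>"] unfolding L_def t_def by blast
        have "L b (what \<omega>) \<ge> 0"
          using psk_decision_eq_1_imp[OF assms(5,1) hat, of b] b(1) unfolding L_def t_def by blast
        with b Lw[OF b(1), of \<omega>] have "L b (what \<omega>) = 0" by linarith
        with elim b(1) show False by (auto simp: Lhat)
      qed
    qed
  qed
  have "\<P>(\<omega> in \<Omega>. dec (what \<omega>) \<noteq> 1) \<le>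
      measure \<Omega> ({\<omega> \<in> space \<Omega>. N 1 \<omega> \<ge> \<alpha> * sin t} \<union> {\<omega> \<in> space \<Omega>. N (-1) \<omega> \<ge> \<alpha> * sin t})"
  proof (rule finite_measure_mono)
    \<comment> \<open>This inclusion is pointwise, because the closed half-planes already contain
      the ties.\<close>
    show "{\<omega> \<in> space \<Omega>. dec (what \<omega>) \<noteq> 1} \<subseteq>
        {\<omega> \<in> space \<Omega>. N 1 \<omega> \<ge> \<alpha> * sin t} \<union> {\<omega> \<in> space \<Omega>. N (-1) \<omega> \<ge> \<alpha> * sin t}"
    proof
      fix \<omega> assume \<omega>: "\<omega> \<in> {\<omega> \<in> space \<Omega>. dec (what \<omega>) \<noteq> 1}"
      then obtain b where b: "b \<in> {1, -1}" "L b (what \<omega>) \<le> 0"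
        using psk_decision_neq_1_imp[OF assms(5,1), of "what \<omega>"] unfolding L_def t_def by blast
      then show "\<omega> \<in> {\<omega> \<in> space \<Omega>. N 1 \<omega> \<ge> \<alpha> * sin t} \<union> {\<omega> \<in> space \<Omega>. N (-1) \<omega> \<ge> \<alpha> * sin t}"
        using \<omega> by (auto simp: Lhat)
    qed
  qed measurable
  also have "\<dots> \<le> \<P>(\<omega> in \<Omega>. N 1 \<omega> \<ge> \<alpha> * sin t) + \<P>(\<omega> in \<Omega>. N (-1) \<omega> \<ge> \<alpha> * sin t)"
    by (rule measure_Un_le) measurable
  \<comment> \<open>\<open>N 1\<close> and \<open>N (-1)\<close> have the same law, so both tails
    have the same value.\<close>
  also have "\<dots> = 2 * Q (\<alpha> * sin t / s)"
    using normal_tail_eq_Q[OF assms(3) N \<open>s > 0\<close>] by simp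
  finally have "\<P>(\<omega> in \<Omega>. dec (what \<omega>) \<noteq> 1) \<le> 2 * Q (\<alpha> / (\<sigma> / sqrt 2) * sin (pi / real M))"
    by (simp add: s_def t_def mult_ac)
  moreover have "\<P>(\<omega> in \<Omega>. dec (w \<omega>) \<noteq> 1) \<le> \<P>(\<omega> in \<Omega>. dec (what \<omega>) \<noteq> 1)"
    by (rule finite_measure_mono_AE) (use dec_w in auto)
  ultimately show ?thesis using zhat by blast
qed

end
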